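(* As $x \to \infty$ through composite odd integers, $$\pi(x) \sim \frac{x}{\lambda_x},$$ that is, $\lim_{x\to\infty} \dfrac{\pi(x)}{x/\lambda_x} = 1$.
   Context: Throughout, $x$ denotes a composite odd positive integer (so $x \ge 9$), and $\pi(x)$ is the number of primes not exceeding $x$. Let $p_n$ be the largest prime not exceeding $x$ (so $p_n < x < p_{n+1}$, where $p_i$ denotes the $i$-th prime). For each pair of consecutive primes $(p_i, p_{i+1})$ with $p_{i+1} - p_i > 2$ and $p_i < x$, consider the sequence of composite integers strictly between $p_i$ and $p_{i+1}$ that do not exceed $x$; thus the sequence is $(p_i+1, \dots, p_{i+1}-1)$ when $p_i < p_n$, and the last one is truncated at $x$, being $(p_n+1, \dots, x)$. Let $\mathscr{S}_1 = \{(8,9,10), (14,15,16), (20,21,22), \dots, (p_n+1,\dots,x)\}$ be the set of all these sequences. Then $\lambda_x$ is the average number of composite integers per sequence in $\mathscr{S}_1$: $$\lambda_x = \frac{\left|\bigcup_{s \in \mathscr{S}_1} s\right|}{|\mathscr{S}_1|},$$ where the union is the set of all integers occurring in the sequences. (For example, for $x=25$, $\lambda_x = 11/4$.) *)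

theory Defs
  imports Complex_Main "HOL-Computational_Algebra.Primes"
begin

definition composite :: "nat \<Rightarrow> bool" where
  "composite m \<longleftrightarrow> 1 < m \<and> \<not> prime m"

definition prime_pi :: "nat \<Rightarrow> nat" where
  "prime_pi x = card {p. prime p \<and> p \<le> x}"

definition consecutive_primes :: "nat \<Rightarrow> nat \<Rightarrow> bool" where
  "consecutive_primes p q \<longleftrightarrow> prime p \<and> prime q \<and> p < q \<and> (\<forall>r. p < r \<and> r < q \<longrightarrow> \<not> prime r)"

(* The increasing sequence of the composites strictly between p and q; the bound x truncates
   the last sequence. *)
definition composite_seq :: "nat \<Rightarrow> nat \<Rightarrow> nat \<Rightarrow> nat list" where
  "composite_seq x p q = filter (\<lambda>m. composite m \<and> m \<le> x) [Suc p..<q]"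

(* The condition p + 2 < q is the gap condition q - p > 2, without truncated subtraction. *)
definition S1 :: "nat \<Rightarrow> nat list set" where
  "S1 x = {composite_seq x p q | p q. consecutive_primes p q \<and> p + 2 < q \<and> p < x}"

definition avg_composites :: "nat \<Rightarrow> real" where
  "avg_composites x = real (card (\<Union>s\<in>S1 x. set s)) / real (card (S1 x))"

end

theory Submission
  imports Defs "HOL-Number_Theory.Cong" "HOL-Analysis.Harmonic_Numbers" "HOL-Real_Asymp.Real_Asymp"
begin

text \<open>
  A composite number that is at most \<open>x\<close> lies in one of the sequences unless it is the middle
  of a pair of twin primes, and the sequences correspond to the primes \<open>p < x\<close> that are followed
  by a gap larger than 2. Let \<open>U\<close> be the number of integers in the sequences and \<open>T(x)\<close> the number
  of \<open>p < x\<close> for which \<open>p\<close> and \<open>p + 2\<close> are prime. Then \<open>x - 1 - \<pi>(x) - T(x) \<le> U \<le> x\<close> and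
  \<open>\<pi>(x) - 1 - T(x) \<le> \<bar>S1\<bar> \<le> \<pi>(x)\<close>, so the quotient in question, which equals
  \<open>(U / x) \<cdot> (\<pi>(x) / \<bar>S1\<bar>)\<close>, tends to 1 once \<open>\<pi>(x) = o(x)\<close> and \<open>T(x) = o(\<pi>(x))\<close>.

  The arithmetic content is the second relation: twin primes have density zero among the primes.
  Chebyshev's bound \<open>\<pi>(x) \<ge> c x / log x\<close> (\<open>chebyshev_lower\<close>) reduces it to
  \<open>T(x) = o(x / log x)\<close> (\<open>twin_primes_sparse\<close>), which Brun's pure sieve delivers
  (\<open>brun_pure_sieve\<close>). A twin prime \<open>p > z\<close> has no odd prime \<open>q \<le> z\<close> dividing \<open>p (p + 2)\<close>; each such
  \<open>q\<close> forbids two residue classes. With \<open>z = 2 ^ (K + 1)\<close> and inclusion-exclusion cut off at \<open>r\<close>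
  primes there are three terms to control.
  \<^item> The main term is \<open>x\<close> times the product of \<open>1 - 2/q\<close>, of order \<open>x / K\<^sup>2\<close> by a Mertens-type
    bound (\<open>prod_odd_primes_le\<close>).
  \<^item> The tail of the expansion is \<open>O(x / K\<^sup>2)\<close> if \<open>r\<close> is a suitable multiple of
    \<open>log K\<close>, because the reciprocals of the primes up to \<open>z\<close> add up to \<open>O(log K)\<close>
    (\<open>sum_inverse_odd_primes_le\<close>).
  \<^item> The rounding errors are at most a constant times \<open>(2 z) ^ r\<close>, that is \<open>exp(O(K log K))\<close>.

  With \<open>K\<close> close to \<open>(log x) ^ (2/3)\<close> all three are \<open>o(x / log x)\<close>: an exponent above \<open>1/2\<close>
  makes \<open>1 / K\<^sup>2\<close> beat \<open>1 / log x\<close>, and an exponent below 1 keeps the rounding errors small.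
\<close>

section \<open>Chebyshev's bounds\<close>

text \<open>
  The numbers \<open>1 / ((n + 1) (n choose k))\<close> form the Leibniz harmonic triangle, in which
  an entry is the difference of two neighbours: the one above it and the one to its left. So if
  \<open>M\<close> clears the denominators on the left edge, which are \<open>1, \<dots>, n + 1\<close>, it clears them all.
\<close>
lemma leibniz_denominator_dvd:
  fixes M :: nat
  assumes "\<And>i. 1 \<le> i \<Longrightarrow> i \<le> Suc n \<Longrightarrow> i dvd M" and "k \<le> n"
  shows "Suc n * (n choose k) dvd M"
  using assms
proof (induction n arbitrary: k)
  case 0
  then show ?case by simp
next
  case (Suc n)
  note IH = Suc.IH and dvd_M = Suc.prems(1)
  from Suc.prems(2) show ?case
  proof (induction k)
    case 0
    then show ?case using dvd_M[of "Suc (Suc n)"] by simp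
  next
    case (Suc k)
    define a where "a = Suc n * (n choose k)"
    define b where "b = Suc (Suc n) * (Suc n choose k)"
    define c where "c = Suc (Suc n) * (Suc n choose Suc k)"
    have "a dvd M" unfolding a_def using Suc.prems dvd_M by (intro IH) auto
    moreover have "b dvd M" unfolding b_def using Suc by simp
    ultimately obtain u v where u: "M = a * u" and v: "M = b * v" unfolding dvd_def by blast
    have pos: "a > 0" "b > 0" "c > 0"
      using Suc.prems by (auto simp: a_def b_def c_def simp del: binomial_Suc_Suc)
    have k: "k \<le> n" using Suc.prems by simp
    \<comment> \<open>With \<open>t = (n + 2) a\<close> these say that \<open>1/c = (k + 1)/t\<close> and \<open>1/b = (n + 1 - k)/t\<close>.\<close>
    have ca: "Suc k * c = Suc (Suc n) * a"
      unfolding a_def c_def by (metis Suc_times_binomial_eq mult.left_commute mult.commute)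
    have ba: "(Suc n - k) * b = Suc (Suc n) * a"
      unfolding a_def b_def using binomial_absorb_comp[of "Suc n" k] k
      by (metis diff_Suc_1 mult.left_commute)
    have "(real n + 1 - real k) * real b = (real n + 2) * real a"
      using arg_cong[OF ba, of real] k by (simp only: of_nat_mult of_nat_diff le_SucI of_nat_Suc) (simp add: algebra_simps)
    then have "(real n + 2) * (real b - real a) = (real k + 1) * real b"
      by (simp add: algebra_simps)
    moreover have "(real k + 1) * real c = (real n + 2) * real a"
      using arg_cong[OF ca, of real] by (simp add: algebra_simps)
    ultimately have "(real n + 2) * (real c * (real b - real a)) = (real n + 2) * (real a * real b)"
      by algebra
    \<comment> \<open>This is the triangle relation \<open>1/c = 1/a - 1/b\<close>, cleared of denominators.\<close>
    then have cab: "real c * (real b - real a) = real a * real b" by simp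
    have "real_of_int (int c * (int u - int v)) * (real a * real b) = real M * (real c * (real b - real a))"
      using arg_cong[OF u, of real] arg_cong[OF v, of real] by (simp add: algebra_simps)
    then have "real_of_int (int c * (int u - int v)) = real_of_int (int M)"
      unfolding cab using pos by simp
    then have "int M = int c * (int u - int v)" by linarith
    then have "int c dvd int M" by simp
    then show ?case unfolding c_def by (simp only: of_nat_dvd_iff)
  qed
qed

lemma four_pow_le_central_binomial: "4 ^ n \<le> Suc (2 * n) * (2 * n choose n)"
proof -
  have "(4::nat) ^ n = (\<Sum>k\<le>2*n. (2*n) choose k)"
    by (simp add: choose_row_sum power_mult)
  also have "\<dots> \<le> (\<Sum>k\<le>2*n. (2*n) choose n)"
    by (intro sum_mono binomial_maximum')
  finally show ?thesis by simp
qed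

lemma finite_primes_le [simp]: "finite {p::nat. prime p \<and> p \<le> n}"
  by (rule finite_subset[of _ "{..n}"]) auto

text \<open>
  The product of the largest prime powers not exceeding \<open>m\<close>, one for each prime, is a common
  multiple, and each of its \<open>\<pi>(m)\<close> factors is at most \<open>m\<close>.
\<close>
lemma common_multiple_le_pow_prime_pi:
  fixes m :: nat
  assumes "m \<ge> 1"
  obtains M where "\<And>i. 1 \<le> i \<Longrightarrow> i \<le> m \<Longrightarrow> i dvd M" and "0 < M" and "M \<le> m ^ prime_pi m"
proof -
  define P where "P = {p. prime p \<and> p \<le> m}"
  have fin: "finite P" by (simp add: P_def)
  have "\<exists>a. p ^ a \<le> m \<and> m < p ^ Suc a" if "p \<in> P" for p
    using ex_power_ivl1[of p m] that assms prime_ge_2_nat[of p] by (auto simp: P_def)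
  then obtain a where a: "\<And>p. p \<in> P \<Longrightarrow> p ^ a p \<le> m \<and> m < p ^ Suc (a p)" by metis
  define M where "M = (\<Prod>p\<in>P. p ^ a p)"
  show thesis
  proof
    fix i assume i: "1 \<le> i" "i \<le> m"
    have "i = (\<Prod>p\<in>prime_factors i. p ^ multiplicity p i)"
      using i by (simp add: prime_factorization_nat)
    also have "\<dots> dvd (\<Prod>p\<in>prime_factors i. p ^ a p)"
    proof (rule prod_dvd_prod, rule le_imp_power_dvd, rule ccontr)
      fix p assume p: "p \<in> prime_factors i" "\<not> multiplicity p i \<le> a p"
      then have "p \<in> P" using i dvd_imp_le[of p i] by (auto simp: P_def prime_factors_dvd)
      have "p ^ Suc (a p) dvd i" using p by (intro multiplicity_dvd') auto
      then show False using a[OF \<open>p \<in> P\<close>] i dvd_imp_le[of "p ^ Suc (a p)" i] by linarith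
    qed
    also have "\<dots> dvd M" unfolding M_def
      using i by (intro prod_dvd_prod_subset fin)
        (auto simp: P_def prime_factors_dvd intro: order.trans[OF dvd_imp_le])
    finally show "i dvd M" .
  next
    show "0 < M" unfolding M_def by (intro prod_pos) (auto simp: P_def prime_gt_0_nat)
    show "M \<le> m ^ prime_pi m"
      unfolding M_def prime_pi_def P_def[symmetric] using prod_mono[of P "\<lambda>p. p ^ a p" "\<lambda>_. m"] a by simp
  qed
qed

text \<open>
  A common multiple of \<open>1, \<dots>, 2 n + 1\<close> is at least the largest denominator in row \<open>2 n\<close> of
  the Leibniz triangle, and that is at least \<open>4 ^ n\<close>.
\<close>
lemma chebyshev_lower_pow: "4 ^ n \<le> Suc (2 * n) ^ prime_pi (Suc (2 * n))"
proof -
  obtain M where M: "\<And>i. 1 \<le> i \<Longrightarrow> i \<le> Suc (2*n) \<Longrightarrow> i dvd M" "0 < M"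
    "M \<le> Suc (2 * n) ^ prime_pi (Suc (2 * n))"
    using common_multiple_le_pow_prime_pi[of "Suc (2 * n)"] by auto
  have "Suc (2 * n) * (2 * n choose n) dvd M" by (intro leibniz_denominator_dvd M) auto
  then have "Suc (2 * n) * (2 * n choose n) \<le> M" using M by (simp add: dvd_imp_le)
  then show ?thesis using four_pow_le_central_binomial[of n] M by linarith
qed

lemma chebyshev_lower:
  assumes "odd x" "x > 1"
  shows "real (prime_pi x) \<ge> (real x - 1) * ln 2 / ln (real x)"
proof -
  obtain n where n: "x = Suc (2 * n)" using assms by (auto elim: oddE)
  have "real n * ln 4 = ln (real (4 ^ n))" by (simp add: ln_realpow)
  also have "\<dots> \<le> ln (real (x ^ prime_pi x))"
  proof (subst ln_le_cancel_iff)
    show "real (4 ^ n) \<le> real (x ^ prime_pi x)"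
      unfolding n of_nat_le_iff by (rule chebyshev_lower_pow)
  qed (use assms in auto)
  also have "\<dots> = prime_pi x * ln x" using assms by (simp add: ln_realpow)
  finally have "2 * real n * ln 2 \<le> prime_pi x * ln x"
    using ln_realpow[of 2 2] by simp
  then show ?thesis using assms n by (simp add: divide_simps)
qed

lemma prod_primes_dvd:
  fixes M :: nat
  assumes "finite A" "\<And>p. p \<in> A \<Longrightarrow> prime p" "\<And>p. p \<in> A \<Longrightarrow> p dvd M"
  shows "\<Prod>A dvd M"
  using assms
proof (induction A rule: finite_induct)
  case (insert p A)
  have "coprime p (\<Prod>A)"
    using insert by (intro prod_coprime_right) (metis insertCI primes_coprime)
  then show ?case using insert by (simp add: divides_mult)
qed simp

text \<open>
  All primes between \<open>n\<close> and \<open>2 n\<close> divide the central binomial coefficient, since they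
  divide \<open>(2 n)!\<close> but not \<open>n!\<close>.
\<close>
lemma pow_card_primes_le:
  assumes "A = {p. prime p \<and> n < p \<and> p \<le> 2 * n}"
  shows "n ^ card A \<le> 4 ^ n"
proof -
  have fin: "finite A" unfolding assms by (rule finite_subset[of _ "{..2*n}"]) auto
  have "p dvd (2 * n choose n)" if "p \<in> A" for p
  proof -
    have p: "prime p" "n < p" "p \<le> 2 * n" using that assms by auto
    have "p dvd fact (2 * n)" using p by (simp add: prime_dvd_fact_iff)
    also have "fact (2 * n) = fact n * fact n * (2 * n choose n)"
      using binomial_fact_lemma[of n "2 * n"] by (simp add: mult_2)
    finally show ?thesis using p by (simp add: prime_dvd_mult_iff prime_dvd_fact_iff)
  qed
  then have "\<Prod>A dvd (2 * n choose n)" by (intro prod_primes_dvd fin) (auto simp: assms)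
  then have "\<Prod>A \<le> (2 * n choose n)" by (simp add: dvd_imp_le)
  also have "\<dots> \<le> 2 ^ (2 * n)" by (rule binomial_le_pow2)
  finally have "\<Prod>A \<le> 4 ^ n" by (simp add: power_mult)
  moreover have "(\<Prod>p\<in>A. n) \<le> \<Prod>A" by (rule prod_mono) (auto simp: assms)
  ultimately show ?thesis by simp
qed

lemma card_primes_dyadic:
  "k * card {p::nat. prime p \<and> 2 ^ k < p \<and> p \<le> 2 ^ Suc k} \<le> 2 ^ Suc k" (is "k * card ?A \<le> _")
proof -
  have "(2::nat) ^ (k * card ?A) = (2 ^ k) ^ card ?A" by (simp add: power_mult)
  also have "\<dots> \<le> 4 ^ (2 ^ k)" by (rule pow_card_primes_le) simp
  also have "\<dots> = 2 ^ (2 ^ Suc k)" by (simp add: power_mult)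
  finally show ?thesis by simp
qed

lemma prime_pi_le: "prime_pi n \<le> n"
proof -
  have "prime_pi n \<le> card {1..n}" unfolding prime_pi_def
    by (intro card_mono) (auto dest: prime_gt_0_nat simp: Suc_le_eq)
  then show ?thesis by simp
qed

lemma prime_pi_mono: "m \<le> n \<Longrightarrow> prime_pi m \<le> prime_pi n"
  unfolding prime_pi_def by (intro card_mono) auto

text \<open>
  The dyadic bounds add up like a geometric series, so the last block dominates. The constant 4
  is large enough for the step from \<open>K\<close> to \<open>K + 1\<close> when \<open>K \<ge> 3\<close>; for small \<open>K\<close> the trivial bound
  on \<open>prime_pi\<close> suffices.
\<close>
lemma prime_pi_pow2: "K * prime_pi (2 ^ K) \<le> 4 * 2 ^ K"
proof (cases "K \<le> 4")
  case True
  then show ?thesis using mult_le_mono[OF True prime_pi_le] by blast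
next
  case False
  then have "3 \<le> K" by simp
  then show ?thesis
  proof (induction K rule: dec_induct)
    case base
    show ?case using prime_pi_le[of "2 ^ 3"] by simp
  next
    case (step K)
    let ?A = "{p::nat. prime p \<and> 2 ^ K < p \<and> p \<le> 2 ^ Suc K}"
    have "{p::nat. prime p \<and> p \<le> 2 ^ Suc K} = {p. prime p \<and> p \<le> 2 ^ K} \<union> ?A" by auto
    then have "prime_pi (2 ^ Suc K) \<le> prime_pi (2 ^ K) + card ?A"
      unfolding prime_pi_def by (metis card_Un_le)
    then have "K * prime_pi (2 ^ Suc K) \<le> K * prime_pi (2 ^ K) + K * card ?A"
      by (metis add_mult_distrib2 mult_le_mono2)
    also have "\<dots> \<le> 4 * 2 ^ K + 2 ^ Suc K"
      using step.IH card_primes_dyadic[of K] by linarith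
    finally have *: "K * prime_pi (2 ^ Suc K) \<le> 6 * 2 ^ K" by simp
    have "3 * (Suc K * prime_pi (2 ^ Suc K)) \<le> 4 * (K * prime_pi (2 ^ Suc K))"
      using step.hyps by (simp add: algebra_simps)
    with * have "Suc K * prime_pi (2 ^ Suc K) \<le> 8 * 2 ^ K" by linarith
    then show ?case by simp
  qed
qed

lemma chebyshev_upper:
  assumes "N \<ge> 1"
  shows "real (prime_pi N) * ln (real N) \<le> 8 * real N"
proof -
  obtain K where K: "2 ^ K \<le> N" "N < 2 ^ Suc K" using ex_power_ivl1[of 2 N] assms by auto
  have "Suc K * prime_pi N \<le> Suc K * prime_pi (2 ^ Suc K)"
    using K by (intro mult_le_mono2 prime_pi_mono) simp
  also have "\<dots> \<le> 8 * N" using prime_pi_pow2[of "Suc K"] K by simp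
  finally have "real (Suc K * prime_pi N) \<le> 8 * real N" by linarith
  moreover have "ln (real N) \<le> real (Suc K)"
  proof -
    have "ln (real N) \<le> ln (real (2 ^ Suc K))" 
      using K assms by (subst ln_le_cancel_iff) (auto simp del: of_nat_power)
    also have "\<dots> = real (Suc K) * ln 2" unfolding of_nat_power by (subst ln_realpow) simp_all
    also have "\<dots> \<le> real (Suc K) * 1" using ln_2_less_1 by (intro mult_left_mono) auto
    finally show ?thesis by simp
  qed
  then have "real (prime_pi N) * ln (real N) \<le> real (prime_pi N) * real (Suc K)"
    by (rule mult_left_mono) simp
  moreover have "real (Suc K * prime_pi N) = real (prime_pi N) * real (Suc K)"
    by (simp only: of_nat_mult mult.commute)
  ultimately show ?thesis by linarith
qed

definition odd_primes :: "nat \<Rightarrow> nat set" where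
  "odd_primes z = {p. prime p \<and> odd p \<and> p \<le> z}"

lemma finite_odd_primes [simp]: "finite (odd_primes z)"
  unfolding odd_primes_def by (rule finite_subset[of _ "{..z}"]) auto

text \<open>
  The \<open>k\<close>-th dyadic block of primes contributes \<open>O(1/k)\<close>, so the sum grows like the logarithm of
  the number of blocks. The factor 2 in the numerator is the number of residue classes that a prime
  forbids to twin primes.
\<close>
lemma sum_inverse_odd_primes_le:
  assumes "K \<ge> 1"
  shows "(\<Sum>p\<in>odd_primes (2 ^ Suc K). 2 / real p) \<le> 4 + 4 * ln (real K)"
  using assms
proof (induction K rule: dec_induct)
  case base
  have "p = 3" if "p \<in> odd_primes 4" for p
  proof -
    have "p \<in> {0,1,2,3,4}" using that by (auto simp: odd_primes_def)
    then show ?thesis using that by (auto simp: odd_primes_def)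
  qed
  then have "odd_primes 4 \<subseteq> {3}" by auto
  then have "(\<Sum>p\<in>odd_primes 4. 2 / real p) \<le> (\<Sum>p\<in>{3}. 2 / real p)"
    by (intro sum_mono2) auto
  then show ?case by simp
next
  case (step K)
  let ?A = "{p::nat. prime p \<and> 2 ^ Suc K < p \<and> p \<le> 2 ^ Suc (Suc K)}"
  have finA: "finite ?A" by (rule finite_subset[of _ "{..2 ^ Suc (Suc K)}"]) auto
  have "(\<Sum>p\<in>?A. 2 / real p) \<le> (\<Sum>p\<in>?A. 2 / 2 ^ Suc K)"
  proof (intro sum_mono divide_left_mono)
    fix p assume "p \<in> ?A"
    then have "real (2 ^ Suc K) \<le> real p" by (subst of_nat_le_iff) auto
    then show "2 ^ Suc K \<le> real p" by simp
  qed (auto dest: prime_gt_0_nat)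
  also have "\<dots> = card ?A * (2 / 2 ^ Suc K)" by simp
  also have "\<dots> \<le> 4 / real (Suc K)"
  proof -
    have "real (Suc K * card ?A) \<le> real (2 ^ Suc (Suc K))"
      using card_primes_dyadic[of "Suc K"] by (subst of_nat_le_iff)
    then show ?thesis by (simp add: field_simps)
  qed
  also have "\<dots> \<le> 4 * (ln (real (Suc K)) - ln (real K))"
  proof -
    have "ln (real K / real (Suc K)) \<le> real K / real (Suc K) - 1"
      using step.hyps by (intro ln_le_minus_one) auto
    also have "\<dots> = - 1 / real (Suc K)" by (simp add: field_simps)
    finally show ?thesis using step.hyps by (simp add: ln_div)
  qed
  finally have A: "(\<Sum>p\<in>?A. 2 / real p) \<le> 4 * (ln (real (Suc K)) - ln (real K))" .
  have "(\<Sum>p\<in>odd_primes (2 ^ Suc (Suc K)). 2 / real p)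
      \<le> (\<Sum>p\<in>odd_primes (2 ^ Suc K) \<union> ?A. 2 / real p)"
    using finA by (intro sum_mono2) (auto simp: odd_primes_def)
  also have "\<dots> = (\<Sum>p\<in>odd_primes (2 ^ Suc K). 2 / real p) + (\<Sum>p\<in>?A. 2 / real p)"
    using finA by (intro sum.union_disjoint) (auto simp: odd_primes_def)
  also have "\<dots> \<le> (4 + 4 * ln (real K)) + 4 * (ln (real (Suc K)) - ln (real K))"
    by (intro add_mono step.IH A)
  also have "\<dots> = 4 + 4 * ln (real (Suc K))" by (simp add: algebra_simps)
  finally show ?case .
qed

section \<open>A Mertens-type bound for the sieving product\<close>

text \<open>
  The finite Euler product, as an inequality and without infinite series. Adjoining a prime \<open>q\<close>
  to \<open>P\<close>, a number over the larger set is either free of \<open>q\<close> or \<open>q\<close> times a smaller such number, so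
  the new sum \<open>s'\<close> and the old one \<open>s\<close> satisfy \<open>s' \<le> s + s' / q\<close>.
\<close>
lemma sum_inverse_smooth_le:
  fixes P :: "nat set"
  assumes "finite P" "\<And>p. p \<in> P \<Longrightarrow> prime p"
  shows "(\<Sum>n | 0 < n \<and> n \<le> M \<and> prime_factors n \<subseteq> P. 1 / real n) * (\<Prod>p\<in>P. 1 - 1 / real p) \<le> 1"
  using assms
proof (induction P rule: finite_induct)
  case empty
  have "{n. 0 < n \<and> n \<le> M \<and> prime_factors n \<subseteq> {}} \<subseteq> {1::nat}"
    by (auto simp: prime_factorization_empty_iff)
  then have "(\<Sum>n | 0 < n \<and> n \<le> M \<and> prime_factors n \<subseteq> {}. 1 / real n) \<le> (\<Sum>n\<in>{1}. 1 / real n)"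
    by (intro sum_mono2) auto
  then show ?case by simp
next
  case (insert q P)
  define S where "S P = {n::nat. 0 < n \<and> n \<le> M \<and> prime_factors n \<subseteq> P}" for P
  have q: "prime q" using insert by auto
  then have q2: "real q \<ge> 2" using prime_ge_2_nat[of q] by simp
  have finS: "finite (S P)" for P unfolding S_def by (rule finite_subset[of _ "{..M}"]) auto
  let ?s = "\<lambda>P. \<Sum>n\<in>S P. 1 / real n"
  have sub: "S (insert q P) \<subseteq> S P \<union> (\<lambda>m. q * m) ` S (insert q P)"
  proof
    fix n assume n: "n \<in> S (insert q P)"
    show "n \<in> S P \<union> (\<lambda>m. q * m) ` S (insert q P)"
    proof (cases "q dvd n")
      case True
      then obtain m where m: "n = q * m" by (elim dvdE)
      have m0: "m > 0" "m \<le> M" using n m q2 by (auto simp: S_def intro: order.trans[rotated])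
      moreover have "prime_factors m \<subseteq> prime_factors n"
        using n by (intro dvd_prime_factors) (auto simp: S_def m)
      then have "prime_factors m \<subseteq> insert q P" using n by (auto simp: S_def)
      ultimately show ?thesis using m by (auto simp: S_def)
    qed (use n in \<open>auto simp: S_def prime_factors_dvd\<close>)
  qed
  have "?s (insert q P) \<le> (\<Sum>n\<in>S P \<union> (\<lambda>m. q * m) ` S (insert q P). 1 / real n)"
    using finS sub by (intro sum_mono2) auto
  also have "\<dots> \<le> ?s P + (\<Sum>n\<in>(\<lambda>m. q * m) ` S (insert q P). 1 / real n)"
    using finS by (subst sum.union_inter[symmetric]) (auto intro!: sum_nonneg)
  also have "(\<Sum>n\<in>(\<lambda>m. q * m) ` S (insert q P). 1 / real n) = (1 / q) * ?s (insert q P)"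
    using q2 by (subst sum.reindex) (auto simp: inj_on_def sum_distrib_left)
  finally have "?s (insert q P) * (1 - 1 / q) \<le> ?s P" by (simp add: algebra_simps)
  moreover have "0 \<le> (\<Prod>p\<in>P. 1 - 1 / real p)"
    using insert.prems by (intro prod_nonneg) (simp add: prime_ge_1_nat Suc_le_eq prime_gt_0_nat)
  ultimately have "?s (insert q P) * (1 - 1 / q) * (\<Prod>p\<in>P. 1 - 1 / real p)
      \<le> ?s P * (\<Prod>p\<in>P. 1 - 1 / real p)" by (rule mult_right_mono)
  also have "\<dots> \<le> 1" using insert.IH insert.prems by (simp add: S_def)
  finally show ?case using insert.hyps by (simp add: S_def mult_ac)
qed

text \<open>
  Every \<open>n \<le> z\<close> is composed of primes up to \<open>z\<close>, so the smooth sum contains the harmonic sum.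
\<close>
lemma mertens_product_upper:
  assumes "z \<ge> 2"
  shows "(\<Prod>p | prime p \<and> p \<le> z. 1 - 1 / real p) \<le> 1 / ln (real z)"
proof -
  let ?P = "{p. prime p \<and> p \<le> z}"
  have "ln (real z) \<le> ln (real z + 1)" using assms by simp
  also have "\<dots> \<le> harm z" by (rule harm_ge_ln)
  also have "\<dots> = (\<Sum>n | 0 < n \<and> n \<le> z \<and> prime_factors n \<subseteq> ?P. 1 / real n)"
    unfolding harm_def 
    by (intro sum.cong) (auto simp: prime_factors_dvd inverse_eq_divide intro: order.trans[OF dvd_imp_le])
  finally have "ln (real z) * (\<Prod>p\<in>?P. 1 - 1 / real p)
      \<le> (\<Sum>n | 0 < n \<and> n \<le> z \<and> prime_factors n \<subseteq> ?P. 1 / real n) * (\<Prod>p\<in>?P. 1 - 1 / real p)"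
    by (intro mult_right_mono prod_nonneg) (auto dest!: prime_ge_1_nat)
  also have "\<dots> \<le> 1" by (intro sum_inverse_smooth_le) auto
  finally show ?thesis using assms by (simp add: field_simps)
qed

text \<open>
  Uses \<open>1 - 2/p \<le> (1 - 1/p)\<^sup>2\<close>; the factor 4 makes up for the missing prime 2.
\<close>
lemma prod_odd_primes_le:
  assumes "z \<ge> 2"
  shows "(\<Prod>p\<in>odd_primes z. 1 - 2 / real p) \<le> 4 / (ln (real z))\<^sup>2"
proof -
  let ?P = "{p. prime p \<and> p \<le> z}"
  have P: "?P = insert 2 (odd_primes z)"
    using assms by (auto simp: odd_primes_def) (metis primes_dvd_imp_eq two_is_prime_nat)
  have p3: "real p \<ge> 3" if "p \<in> odd_primes z" for p
    using that prime_ge_2_nat[of p] by (cases "p = 2") (auto simp: odd_primes_def)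
  have "(\<Prod>p\<in>odd_primes z. 1 - 2 / real p) \<le> (\<Prod>p\<in>odd_primes z. (1 - 1 / real p)\<^sup>2)"
  proof (rule prod_mono, intro conjI)
    fix p assume "p \<in> odd_primes z"
    note p3[OF this]
    then show "0 \<le> 1 - 2 / real p" by simp
    show "1 - 2 / real p \<le> (1 - 1 / real p)\<^sup>2" by (simp add: power2_eq_square algebra_simps)
  qed
  also have "\<dots> = (\<Prod>p\<in>odd_primes z. 1 - 1 / real p)\<^sup>2" by (simp add: prod_power_distrib)
  also have "(\<Prod>p\<in>odd_primes z. 1 - 1 / real p) = 2 * (\<Prod>p\<in>?P. 1 - 1 / real p)"
    unfolding P by (subst prod.insert) (auto simp: odd_primes_def)
  also have "\<dots>\<^sup>2 \<le> (2 * (1 / ln (real z)))\<^sup>2"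
    using mertens_product_upper[OF assms]
    by (intro power_mono mult_left_mono mult_nonneg_nonneg prod_nonneg) (auto dest!: prime_ge_1_nat)
  finally show ?thesis by (simp add: power_divide)
qed

section \<open>Brun's pure sieve\<close>

text \<open>
  Truncating inclusion-exclusion after an even number of steps overestimates: the truncated
  alternating sum of \<open>b choose k\<close> is \<open>b - 1 choose r\<close>, which is nonnegative for \<open>b \<ge> 1\<close>.
\<close>
lemma bonferroni_even:
  assumes "finite B" "even r"
  shows "(if B = {} then 1 else 0) \<le> (\<Sum>D | D \<subseteq> B \<and> card D \<le> r. (-1 :: real) ^ card D)"
proof -
  let ?S = "{D. D \<subseteq> B \<and> card D \<le> r}"
  have "(\<Sum>D\<in>?S. (-1 :: real) ^ card D) = (\<Sum>k\<le>r. \<Sum>D | D \<in> ?S \<and> card D = k. (-1) ^ card D)"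
    by (rule sum.group[symmetric]) (use assms in auto)
  also have "\<dots> = (\<Sum>k\<le>r. \<Sum>D | D \<subseteq> B \<and> card D = k. (-1) ^ card D)"
    by (intro sum.cong refl) auto
  also have "\<dots> = (\<Sum>k\<le>r. (real (card B) gchoose k) * (-1) ^ k)"
    using assms by (intro sum.cong refl) (simp add: n_subsets binomial_gbinomial)
  also have "\<dots> = (-1) ^ r * (real (card B) - 1 gchoose r)"
    by (rule gbinomial_sum_lower_neg)
  also have "\<dots> = (real (card B) - 1 gchoose r)" using assms by simp
  finally have *: "(\<Sum>D | D \<subseteq> B \<and> card D \<le> r. (-1 :: real) ^ card D) = (real (card B) - 1 gchoose r)" .
  show ?thesis
  proof (cases "B = {}")
    case True
    then have "{D. D \<subseteq> B \<and> card D \<le> r} = {{}}" by auto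
    then show ?thesis using True by simp
  next
    case False
    then have "real (card B) - 1 = real (card B - 1)"
      using assms by (simp add: card_gt_0_iff of_nat_diff Suc_le_eq)
    then show ?thesis unfolding * using False by (simp only: binomial_gbinomial[symmetric]) simp
  qed
qed

text \<open>
  Rankin's trick: weighting every subset with \<open>exp (card D - r)\<close>, which is at least 1 on the
  subsets that count, allows the sum to be extended to all subsets, where it becomes a product.
\<close>
lemma rankin_large_subsets:
  fixes g :: "'a \<Rightarrow> real"
  assumes "finite P" "\<And>p. p \<in> P \<Longrightarrow> g p \<ge> 0"
  shows "(\<Sum>D | D \<subseteq> P \<and> r < card D. \<Prod>p\<in>D. g p) \<le> exp (- real r + exp 1 * (\<Sum>p\<in>P. g p))"
proof -
  have nn: "0 \<le> (\<Prod>p\<in>D. g p)" if "D \<subseteq> P" for D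
    using that assms by (intro prod_nonneg) auto
  have "(\<Sum>D | D \<subseteq> P \<and> r < card D. \<Prod>p\<in>D. g p)
      \<le> (\<Sum>D | D \<subseteq> P \<and> r < card D. exp (- real r) * (\<Prod>p\<in>D. exp 1 * g p))"
  proof (rule sum_mono)
    fix D assume D: "D \<in> {D. D \<subseteq> P \<and> r < card D}"
    have "1 * (\<Prod>p\<in>D. g p) \<le> exp (real (card D) - real r) * (\<Prod>p\<in>D. g p)"
      using D nn by (intro mult_right_mono) auto
    also have "exp (real (card D) - real r) = exp (- real r) * exp 1 ^ card D"
      by (simp flip: exp_of_nat_mult exp_add)
    finally show "(\<Prod>p\<in>D. g p) \<le> exp (- real r) * (\<Prod>p\<in>D. exp 1 * g p)"
      by (simp add: prod.distrib mult_ac)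
  qed
  also have "\<dots> \<le> (\<Sum>D\<in>Pow P. exp (- real r) * (\<Prod>p\<in>D. exp 1 * g p))"
    using assms nn by (intro sum_mono2) (auto simp: prod.distrib)
  also have "\<dots> = exp (- real r) * (\<Prod>p\<in>P. exp 1 * g p + 1)"
    using assms(1) by (simp add: prod_add sum_distrib_left)
  also have "\<dots> \<le> exp (- real r) * (\<Prod>p\<in>P. exp (exp 1 * g p))"
    using assms by (intro mult_left_mono prod_mono) (auto simp: add.commute[of _ 1])
  also have "\<dots> = exp (- real r + exp 1 * (\<Sum>p\<in>P. g p))"
    unfolding exp_sum[OF assms(1), symmetric] exp_add sum_distrib_left ..
  finally show ?thesis .
qed

text \<open>
  The same trick in the other direction, with weight \<open>y ^ (r - card D)\<close>; the condition on \<open>y\<close>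
  keeps the resulting product of \<open>1 + c / y\<close> at or below \<open>exp 1\<close>.
\<close>
lemma rankin_small_subsets:
  fixes c y :: real
  assumes "finite P" "c \<ge> 0" "y \<ge> 1" "y \<ge> c * card P"
  shows "(\<Sum>D | D \<subseteq> P \<and> card D \<le> r. c ^ card D) \<le> exp 1 * y ^ r"
proof -
  have "(\<Sum>D | D \<subseteq> P \<and> card D \<le> r. c ^ card D)
      \<le> (\<Sum>D | D \<subseteq> P \<and> card D \<le> r. y ^ r * (c / y) ^ card D)"
  proof (rule sum_mono)
    fix D assume D: "D \<in> {D. D \<subseteq> P \<and> card D \<le> r}"
    have "y ^ r * (c / y) ^ card D = y ^ (r - card D) * c ^ card D"
      using D assms by (simp add: power_diff power_divide)
    moreover have "1 * c ^ card D \<le> y ^ (r - card D) * c ^ card D"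
      using assms by (intro mult_right_mono) auto
    ultimately show "c ^ card D \<le> y ^ r * (c / y) ^ card D" by simp
  qed
  also have "\<dots> \<le> (\<Sum>D\<in>Pow P. y ^ r * (c / y) ^ card D)"
    using assms by (intro sum_mono2) auto
  also have "\<dots> = y ^ r * (\<Prod>p\<in>P. c / y + 1)"
    by (subst prod_add) (simp_all add: assms(1) sum_distrib_left)
  also have "\<dots> \<le> y ^ r * (\<Prod>p\<in>P. exp (c / y))"
    using assms by (intro mult_left_mono prod_mono) (auto simp: add.commute[of _ 1])
  also have "\<dots> = y ^ r * exp (c * card P / y)"
    by (simp flip: exp_of_nat_mult add: mult_ac)
  also have "\<dots> \<le> y ^ r * exp 1"
    using assms by (intro mult_left_mono) auto
  finally show ?thesis by (simp add: mult_ac)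
qed

text \<open>
  Here \<open>X\<close> is the approximate size of \<open>\<Omega>\<close>, \<open>g p\<close> the density of the elements that are bad for
  \<open>p\<close>, and \<open>c ^ card D\<close> bounds the error of the assumption that the conditions in \<open>D\<close> are
  independent. The upper Bonferroni inequality is summed over \<open>\<Omega>\<close> and the order of summation
  exchanged; completing the truncated main term to the full product costs the sum over large
  subsets.
\<close>
lemma brun_pure_sieve:
  fixes g :: "'p \<Rightarrow> real" and bad :: "'p \<Rightarrow> 'n \<Rightarrow> bool" and X c y :: real
  assumes fin: "finite \<Omega>" "finite P"
    and g: "\<And>p. p \<in> P \<Longrightarrow> g p \<ge> 0"
    and X: "X \<ge> 0"
    and count: "\<And>D. D \<subseteq> P \<Longrightarrow>
      \<bar>real (card {n \<in> \<Omega>. \<forall>p\<in>D. bad p n}) - X * (\<Prod>p\<in>D. g p)\<bar> \<le> c ^ card D"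
    and c: "c \<ge> 0" and y: "y \<ge> 1" "y \<ge> c * card P"
    and r: "even r"
  shows "real (card {n \<in> \<Omega>. \<forall>p\<in>P. \<not> bad p n})
    \<le> X * ((\<Prod>p\<in>P. 1 - g p) + exp (- real r + exp 1 * (\<Sum>p\<in>P. g p))) + exp 1 * y ^ r"
proof -
  define S where "S = {D. D \<subseteq> P \<and> card D \<le> r}"
  define L where "L = {D. D \<subseteq> P \<and> r < card D}"
  have finS: "finite S" "finite L" using fin by (auto simp: S_def L_def)
  define h where "h D = real (card {n \<in> \<Omega>. \<forall>p\<in>D. bad p n})" for D
  have "{n \<in> \<Omega>. \<forall>p\<in>P. \<not> bad p n} = {n \<in> \<Omega>. {p\<in>P. bad p n} = {}}" by auto
  then have "real (card {n \<in> \<Omega>. \<forall>p\<in>P. \<not> bad p n})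
      = (\<Sum>n\<in>\<Omega>. if {p\<in>P. bad p n} = {} then 1 else 0)"
    using fin(1) by (simp only: sum.inter_filter[symmetric]) simp
  also have "\<dots> \<le> (\<Sum>n\<in>\<Omega>. \<Sum>D | D \<subseteq> {p\<in>P. bad p n} \<and> card D \<le> r. (-1) ^ card D)"
    using fin r by (intro sum_mono bonferroni_even) auto
  also have "\<dots> = (\<Sum>n\<in>\<Omega>. \<Sum>D | D \<in> S \<and> (\<forall>p\<in>D. bad p n). (-1) ^ card D)"
    by (intro sum.cong refl) (auto simp: S_def)
  also have "\<dots> = (\<Sum>D\<in>S. \<Sum>n | n \<in> \<Omega> \<and> (\<forall>p\<in>D. bad p n). (-1) ^ card D)"
    by (rule sum.swap_restrict) (use fin finS in auto)
  also have "\<dots> = (\<Sum>D\<in>S. (-1) ^ card D * h D)"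
    by (simp add: h_def mult.commute)
  also have "\<dots> \<le> (\<Sum>D\<in>S. (-1) ^ card D * (X * (\<Prod>p\<in>D. g p)) + c ^ card D)"
  proof (rule sum_mono)
    fix D assume "D \<in> S"
    then have "\<bar>h D - X * (\<Prod>p\<in>D. g p)\<bar> \<le> c ^ card D"
      using count[of D] by (simp add: S_def h_def)
    then show "(-1) ^ card D * h D \<le> (-1) ^ card D * (X * (\<Prod>p\<in>D. g p)) + c ^ card D"
      by (cases "even (card D)") auto
  qed
  also have "\<dots> = X * (\<Sum>D\<in>S. \<Prod>p\<in>D. - g p) + (\<Sum>D\<in>S. c ^ card D)"
    by (simp add: sum.distrib sum_distrib_left prod_uminus mult_ac)
  also have "(\<Sum>D\<in>S. \<Prod>p\<in>D. - g p) = (\<Prod>p\<in>P. 1 - g p) - (\<Sum>D\<in>L. \<Prod>p\<in>D. - g p)"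
  proof -
    have "(\<Prod>p\<in>P. 1 - g p) = (\<Prod>p\<in>P. - g p + 1)" by simp
    also have "\<dots> = (\<Sum>D\<in>Pow P. \<Prod>p\<in>D. - g p)" using fin by (subst prod_add) auto
    also have "Pow P = S \<union> L" by (auto simp: S_def L_def)
    also have "(\<Sum>D\<in>S \<union> L. \<Prod>p\<in>D. - g p) = (\<Sum>D\<in>S. \<Prod>p\<in>D. - g p) + (\<Sum>D\<in>L. \<Prod>p\<in>D. - g p)"
      using finS by (intro sum.union_disjoint) (auto simp: S_def L_def)
    finally show ?thesis by simp
  qed
  finally have main: "real (card {n \<in> \<Omega>. \<forall>p\<in>P. \<not> bad p n})
    \<le> X * ((\<Prod>p\<in>P. 1 - g p) - (\<Sum>D\<in>L. \<Prod>p\<in>D. - g p)) + (\<Sum>D\<in>S. c ^ card D)" .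
  have "- (\<Sum>D\<in>L. \<Prod>p\<in>D. - g p) \<le> (\<Sum>D\<in>L. \<Prod>p\<in>D. g p)"
    unfolding sum_negf[symmetric]
  proof (rule sum_mono)
    fix D assume "D \<in> L"
    then have "0 \<le> (\<Prod>p\<in>D. g p)" using g by (intro prod_nonneg) (auto simp: L_def)
    then show "- (\<Prod>p\<in>D. - g p) \<le> (\<Prod>p\<in>D. g p)"
      by (cases "even (card D)") (auto simp: prod_uminus)
  qed
  also have "(\<Sum>D\<in>L. \<Prod>p\<in>D. g p) \<le> exp (- real r + exp 1 * (\<Sum>p\<in>P. g p))"
    unfolding L_def by (rule rankin_large_subsets) (use fin g in auto)
  finally have tail: "- (\<Sum>D\<in>L. \<Prod>p\<in>D. - g p) \<le> exp (- real r + exp 1 * (\<Sum>p\<in>P. g p))" .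
  have err: "(\<Sum>D\<in>S. c ^ card D) \<le> exp 1 * y ^ r"
    unfolding S_def by (rule rankin_small_subsets) (use fin c y in auto)
  have "X * ((\<Prod>p\<in>P. 1 - g p) - (\<Sum>D\<in>L. \<Prod>p\<in>D. - g p))
     \<le> X * ((\<Prod>p\<in>P. 1 - g p) + exp (- real r + exp 1 * (\<Sum>p\<in>P. g p)))"
    using tail X by (intro mult_left_mono) linarith+
  from order.trans[OF main add_mono[OF this err]] show ?thesis .
qed

section \<open>Residue classes forbidden to twin primes\<close>

lemma card_residue_class:
  assumes "a < m"
  shows "card {n. n < N \<and> n mod m = a} = (N + (m - 1 - a)) div m"
proof (induction N)
  case 0
  then show ?case using assms by simp
next
  case (Suc N)
  have "{n. n < Suc N \<and> n mod m = a}
      = (if N mod m = a then insert N {n. n < N \<and> n mod m = a} else {n. n < N \<and> n mod m = a})"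
    by (auto simp: less_Suc_eq)
  then have *: "card {n. n < Suc N \<and> n mod m = a} = (if N mod m = a then 1 else 0) + (N + (m - 1 - a)) div m"
    using Suc by simp
  have "N mod m = a \<longleftrightarrow> Suc (N + (m - 1 - a)) mod m = 0"
  proof -
    have "Suc (N + (m - 1 - a)) = N + m - a" using assms by simp
    moreover have "(N + m - a) mod m = 0 \<longleftrightarrow> [N + m = a] (mod m)"
      using assms by (subst cong_altdef_nat) (auto simp: mod_eq_0_iff_dvd)
    ultimately show ?thesis using assms by (simp add: Cong.cong_def)
  qed
  then show ?case unfolding * by (simp add: div_Suc)
qed

lemma card_cong_approx:
  assumes "m > 0"
  shows "\<bar>real (card {n. n < N \<and> [n = a] (mod m)}) - real N / real m\<bar> \<le> 1"
proof -
  let ?e = "m - 1 - a mod m"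
  have "card {n. n < N \<and> [n = a] (mod m)} = (N + ?e) div m"
    using card_residue_class[of "a mod m" m N] assms unfolding Cong.cong_def by simp
  moreover have "real ((N + ?e) div m) \<le> (N + ?e) / m" by (rule of_nat_div_le_of_nat) 
  moreover have "(N + ?e) / m \<le> N / m + 1" using assms by (simp add: field_simps)
  moreover have "N / m - 1 \<le> real ((N + ?e) div m)"
  proof -
    have "N < Suc (N div m) * m" using assms dividend_less_div_times[of m N] by simp
    then have "real N < real (Suc (N div m) * m)" by (simp only: of_nat_less_iff)
    then have "N / m - 1 \<le> real (N div m)" using assms by (simp add: field_simps)
    also have "\<dots> \<le> real ((N + ?e) div m)" by (simp add: div_le_mono)
    finally show ?thesis .
  qed
  ultimately show ?thesis by linarith
qed

text \<open>
  Within the class of \<open>a\<close> modulo \<open>m\<close>, the condition at a new prime \<open>q\<close> selects the two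
  classes modulo \<open>m q\<close> that reduce to \<open>0\<close> and \<open>-2\<close> modulo \<open>q\<close>; they differ because \<open>q\<close> is odd. The residue class is part of the statement so
  that the induction can follow this splitting; the sieve uses it with \<open>m = 1\<close>.
\<close>
lemma card_shifted_divisible_approx:
  fixes D :: "nat set"
  assumes "finite D" "\<And>p. p \<in> D \<Longrightarrow> prime p \<and> odd p \<and> coprime p m" "m > 0"
  shows "\<bar>real (card {n. n < N \<and> [n = a] (mod m) \<and> (\<forall>p\<in>D. p dvd n \<or> p dvd n + 2)})
           - real N / real m * (\<Prod>p\<in>D. 2 / real p)\<bar> \<le> 2 ^ card D"
  using assms
proof (induction D arbitrary: a m rule: finite_induct)
  case empty
  then show ?case using card_cong_approx[of m N a] by simp
next
  case (insert q D)
  define C where "C m a = {n. n < N \<and> [n = a] (mod m) \<and> (\<forall>p\<in>D. p dvd n \<or> p dvd n + 2)}" for m a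
  have finC: "finite (C m a)" for m a unfolding C_def by (rule finite_subset[of _ "{..<N}"]) auto
  have q: "prime q" "odd q" "coprime q m" using insert.prems by auto
  have q3: "q \<ge> 3" using prime_ge_2_nat[of q] q by (cases "q = 2") auto
  obtain b where b: "[b = a] (mod m)" "[b = 0] (mod q)"
    using binary_chinese_remainder_nat[of m q a 0] q by (auto simp: coprime_commute)
  obtain c where c: "[c = a] (mod m)" "[c = q - 2] (mod q)"
    using binary_chinese_remainder_nat[of m q a "q - 2"] q by (auto simp: coprime_commute)
  have split: "[n = a] (mod m) \<and> [n = u] (mod q) \<longleftrightarrow> [n = v] (mod m * q)"
    if "[v = a] (mod m)" "[v = u] (mod q)" for n u v
    using that q by (metis cong_modulus_mult_nat cong_sym cong_trans coprime_cong_mult_nat coprime_commute mult.commute)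
  have dvd2: "q dvd n + 2 \<longleftrightarrow> [n = q - 2] (mod q)" for n
  proof -
    have "[n = q - 2] (mod q) \<longleftrightarrow> [n + 2 = q - 2 + 2] (mod q)" by (rule cong_add_rcancel_nat[symmetric])
    also have "q - 2 + 2 = q" using q3 by simp
    finally show ?thesis by (simp add: Cong.cong_def dvd_eq_mod_eq_0)
  qed
  have eq: "{n. n < N \<and> [n = a] (mod m) \<and> (\<forall>p\<in>insert q D. p dvd n \<or> p dvd n + 2)}
      = C (m * q) b \<union> C (m * q) c"
  proof -
    have "[n = a] (mod m) \<and> (q dvd n \<or> q dvd n + 2)
      \<longleftrightarrow> [n = b] (mod m * q) \<or> [n = c] (mod m * q)" for n
      using split[OF b, of n] split[OF c, of n] unfolding dvd2 cong_0_iff by blast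
    then show ?thesis unfolding C_def by blast
  qed
  have "C (m * q) b \<inter> C (m * q) c = {}"
  proof -
    have False if "n \<in> C (m * q) b" "n \<in> C (m * q) c" for n
    proof -
      have "q dvd n" "q dvd n + 2"
        using that split[OF b, of n] split[OF c, of n] unfolding C_def dvd2 cong_0_iff by blast+
      then have "q dvd 2" using dvd_add_right_iff[of q n 2] by blast
      then show False using q3 by (auto dest: dvd_imp_le)
    qed
    then show ?thesis by auto
  qed
  then have card: "real (card {n. n < N \<and> [n = a] (mod m) \<and> (\<forall>p\<in>insert q D. p dvd n \<or> p dvd n + 2)})
      = real (card (C (m * q) b)) + real (card (C (m * q) c))"
    unfolding eq using finC by (simp add: card_Un_disjoint)
  define t where "t = real N / real (m * q) * (\<Prod>p\<in>D. 2 / real p)"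
  have copr: "prime p \<and> odd p \<and> coprime p (m * q)" if "p \<in> D" for p
  proof -
    have "prime p \<and> odd p \<and> coprime p m" "p \<noteq> q" using that insert.prems insert.hyps by auto
    then show ?thesis using q primes_coprime[of p q] by simp
  qed
  have "\<bar>real (card (C (m * q) v)) - t\<bar> \<le> 2 ^ card D" for v
    unfolding C_def t_def using insert.prems q3 by (intro insert.IH copr) auto
  from this[of b] this[of c]
  have "\<bar>real (card (C (m * q) b)) + real (card (C (m * q) c)) - 2 * t\<bar> \<le> 2 * 2 ^ card D"
    by linarith
  moreover have "2 * t = real N / real m * (\<Prod>p\<in>insert q D. 2 / real p)"
    using insert.hyps by (simp add: t_def)
  ultimately show ?case unfolding card using insert.hyps by simp
qed

section \<open>Twin primes have density zero among the primes\<close>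

definition twin_primes_below :: "nat \<Rightarrow> nat set" where
  "twin_primes_below N = {p. p < N \<and> prime p \<and> prime (p + 2)}"

lemma finite_twin_primes_below [simp]: "finite (twin_primes_below N)"
  unfolding twin_primes_below_def by (rule finite_subset[of _ "{..<N}"]) auto

lemma card_twin_primes_below_le_sieve:
  assumes "even r" "z \<ge> 1"
  shows "real (card (twin_primes_below N)) \<le> real z
    + real N * ((\<Prod>p\<in>odd_primes z. 1 - 2 / real p)
        + exp (- real r + exp 1 * (\<Sum>p\<in>odd_primes z. 2 / real p)))
    + exp 1 * (2 * real z) ^ r"
proof -
  let ?G = "{n \<in> {..<N}. \<forall>p\<in>odd_primes z. \<not> (p dvd n \<or> p dvd n + 2)}"
  have "twin_primes_below N \<subseteq> {1..z} \<union> ?G"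
  proof
    fix n assume n: "n \<in> twin_primes_below N"
    then have pr: "prime n" "prime (n + 2)" "n < N" by (auto simp: twin_primes_below_def)
    show "n \<in> {1..z} \<union> ?G"
    proof (cases "n \<le> z")
      case False
      have "\<not> (p dvd n \<or> p dvd n + 2)" if "p \<in> odd_primes z" for p
        using that pr False primes_dvd_imp_eq[of p n] primes_dvd_imp_eq[of p "n + 2"]
        by (auto simp: odd_primes_def)
      then show ?thesis using pr by auto
    qed (use pr prime_ge_1_nat in auto)
  qed
  then have "card (twin_primes_below N) \<le> card ({1..z} \<union> ?G)" by (intro card_mono) auto
  also have "\<dots> \<le> z + card ?G" using card_Un_le[of "{1..z}" ?G] by simp
  finally have "real (card (twin_primes_below N)) \<le> real z + real (card ?G)" by linarith
  also have "real (card ?G) \<le> real N * ((\<Prod>p\<in>odd_primes z. 1 - 2 / real p)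
        + exp (- real r + exp 1 * (\<Sum>p\<in>odd_primes z. 2 / real p))) + exp 1 * (2 * real z) ^ r"
  proof (rule brun_pure_sieve[where c = 2])
    fix D assume D: "D \<subseteq> odd_primes z"
    have "\<bar>real (card {n. n < N \<and> [n = 0] (mod 1) \<and> (\<forall>p\<in>D. p dvd n \<or> p dvd n + 2)})
           - real N / real 1 * (\<Prod>p\<in>D. 2 / real p)\<bar> \<le> 2 ^ card D"
      using D by (intro card_shifted_divisible_approx finite_subset[OF D]) (auto simp: odd_primes_def)
    then show "\<bar>real (card {n \<in> {..<N}. \<forall>p\<in>D. p dvd n \<or> p dvd n + 2})
           - real N * (\<Prod>p\<in>D. 2 / real p)\<bar> \<le> 2 ^ card D" by simp
  next
    have "card (odd_primes z) \<le> card {1..z}"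
      by (intro card_mono) (auto simp: odd_primes_def dest: prime_ge_1_nat)
    then show "2 * real (card (odd_primes z)) \<le> 2 * real z" by simp
  qed (use assms in auto)
  finally show ?thesis by (simp add: add.assoc)
qed

text \<open>
  The sieve with \<open>z = 2 ^ (K + 1)\<close>. The number of steps \<open>r\<close> is chosen such that the tail
  \<open>exp (- r + 3 (4 + 4 ln K))\<close> is at most \<open>1 / K\<^sup>2\<close>, as small as the main term.
\<close>
lemma card_twin_primes_below_le:
  assumes "K \<ge> 1"
  shows "real (card (twin_primes_below N)) \<le> 2 powr (real K + 1) + 10 * real N / (real K)\<^sup>2
     + 3 * 2 powr ((real K + 2) * (16 + 14 * ln (real K)))"
proof -
  define z where "z = (2::nat) ^ Suc K"
  define r where "r = 2 * nat \<lceil>7 + 7 * ln (real K)\<rceil>"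
  have lnK: "ln (real K) \<ge> 0" using assms by simp
  have r: "14 + 14 * ln (real K) \<le> real r" "real r \<le> 16 + 14 * ln (real K)"
    unfolding r_def using lnK by (auto; linarith)+
  have zr: "real z = 2 powr (real K + 1)" by (simp add: z_def powr_add powr_realpow)
  have "z \<ge> 2" by (simp add: z_def)
  have "(\<Prod>p\<in>odd_primes z. 1 - 2 / real p) \<le> 4 / (ln (real z))\<^sup>2"
    by (rule prod_odd_primes_le) fact
  also have "\<dots> \<le> 4 / (2 / 3 * real K)\<^sup>2"
  proof (intro divide_left_mono power_mono)
    have "2 / 3 * real K \<le> ln 2 * (real K + 1)"
      using ln2_ge_two_thirds by (intro mult_mono) auto
    then show "2 / 3 * real K \<le> ln (real z)" by (simp add: zr ln_powr mult.commute)
    moreover have "0 < 2 / 3 * real K" using assms by simp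
    ultimately have "0 < ln (real z)" by linarith
    then show "0 < (ln (real z))\<^sup>2 * (2 / 3 * real K)\<^sup>2" using assms by simp
  qed auto
  also have "\<dots> = 9 / (real K)\<^sup>2" by (simp add: power_divide power_mult_distrib)
  finally have main: "(\<Prod>p\<in>odd_primes z. 1 - 2 / real p) \<le> 9 / (real K)\<^sup>2" .
  have "exp 1 * (\<Sum>p\<in>odd_primes z. 2 / real p) \<le> 3 * (4 + 4 * ln (real K))"
    using sum_inverse_odd_primes_le[OF assms] exp_le unfolding z_def[symmetric]
    by (intro mult_mono sum_nonneg) auto
  then have "- real r + exp 1 * (\<Sum>p\<in>odd_primes z. 2 / real p) \<le> - real r + 3 * (4 + 4 * ln (real K))"
    by (rule add_left_mono)
  also have "\<dots> \<le> - (2 * ln (real K))" using r(1) by (simp add: algebra_simps)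
  finally have "exp (- real r + exp 1 * (\<Sum>p\<in>odd_primes z. 2 / real p)) \<le> exp (- (2 * ln (real K)))"
    by (subst exp_le_cancel_iff)
  also have "\<dots> = 1 / (real K)\<^sup>2"
    using assms by (simp add: exp_minus exp_double inverse_eq_divide)
  finally have tail: "exp (- real r + exp 1 * (\<Sum>p\<in>odd_primes z. 2 / real p)) \<le> 1 / (real K)\<^sup>2" .
  have "2 * real z = 2 powr (real K + 2)" by (simp add: zr powr_add)
  then have "exp 1 * (2 * real z) ^ r = exp 1 * 2 powr ((real K + 2) * real r)"
    by (simp flip: powr_realpow add: powr_powr)
  also have "\<dots> \<le> 3 * 2 powr ((real K + 2) * (16 + 14 * ln (real K)))"
    using r exp_le by (intro mult_mono powr_mono mult_left_mono) auto
  finally have err: "exp 1 * (2 * real z) ^ r \<le> 3 * 2 powr ((real K + 2) * (16 + 14 * ln (real K)))" .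
  have "real N * ((\<Prod>p\<in>odd_primes z. 1 - 2 / real p)
        + exp (- real r + exp 1 * (\<Sum>p\<in>odd_primes z. 2 / real p)))
      \<le> real N * (9 / (real K)\<^sup>2 + 1 / (real K)\<^sup>2)"
    by (intro mult_left_mono add_mono main tail) auto
  also have "\<dots> = 10 * real N / (real K)\<^sup>2" by (simp flip: add_divide_distrib)
  finally show ?thesis
    using card_twin_primes_below_le_sieve[of r z N] err \<open>z \<ge> 2\<close>
    unfolding zr[symmetric] by (simp add: r_def)
qed

lemma twin_primes_sparse:
  "(\<lambda>N. real (card (twin_primes_below N)) * ln (real N) / real N) \<longlonglongrightarrow> 0"
proof (rule tendsto_sandwich[where f = "\<lambda>_. 0"])
  define s where "s N = ln (real N) powr (2/3)" for N
  define B where "B x = (2 powr (ln x powr (2/3) + 1) + 10 * x / (ln x powr (2/3) - 1)\<^sup>2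
     + 3 * 2 powr ((ln x powr (2/3) + 2) * (16 + 14 * ln (ln x powr (2/3))))) * ln x / x" for x :: real
  have "(B \<longlongrightarrow> 0) at_top" unfolding B_def by real_asymp
  from filterlim_compose[OF this filterlim_real_sequentially]
  show "(\<lambda>N. B (real N)) \<longlonglongrightarrow> 0" .
  \<comment> \<open>It ensures that \<open>K \<ge> 1\<close> and that \<open>s N - 1\<close> is a positive lower bound for \<open>K\<close>.\<close>
  have "\<forall>\<^sub>F N in sequentially. s N \<ge> 2" unfolding s_def by real_asymp
  then show "\<forall>\<^sub>F N in sequentially. real (card (twin_primes_below N)) * ln (real N) / real N \<le> B (real N)"
    using eventually_ge_at_top[of 1]
  proof eventually_elim
    case (elim N)
    define K where "K = nat \<lfloor>s N\<rfloor>"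
    have K: "s N - 1 \<le> real K" "real K \<le> s N" "K \<ge> 1" unfolding K_def using elim by (auto; linarith)+
    have "real (card (twin_primes_below N)) \<le> 2 powr (real K + 1) + 10 * real N / (real K)\<^sup>2
     + 3 * 2 powr ((real K + 2) * (16 + 14 * ln (real K)))"
      by (rule card_twin_primes_below_le) fact
    also have "\<dots> \<le> 2 powr (s N + 1) + 10 * real N / (s N - 1)\<^sup>2
     + 3 * 2 powr ((s N + 2) * (16 + 14 * ln (s N)))"
      using K elim
      by (intro add_mono powr_mono divide_left_mono power_mono mult_left_mono mult_mono) auto
    finally show ?case unfolding B_def s_def using elim
      by (intro divide_right_mono mult_right_mono) auto
  qed
  show "\<forall>\<^sub>F N in sequentially. 0 \<le> real (card (twin_primes_below N)) * ln (real N) / real N"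
    using eventually_ge_at_top[of 1] by eventually_elim simp
qed simp

section \<open>Prime gaps and the sequences of composites\<close>

definition long_gap_starts :: "nat \<Rightarrow> nat set" where
  "long_gap_starts x = {p. \<exists>q. consecutive_primes p q \<and> p + 2 < q \<and> p < x}"

lemma consecutive_primes_unique:
  "consecutive_primes p q \<Longrightarrow> consecutive_primes p q' \<Longrightarrow> q = q'"
  unfolding consecutive_primes_def by (metis linorder_neqE_nat)

lemma ex_consecutive_prime:
  assumes "prime p"
  obtains q where "consecutive_primes p q"
proof -
  define q where "q = (LEAST q. prime q \<and> p < q)"
  have "\<exists>q. prime q \<and> p < q" using bigger_prime by blast
  then have "prime q \<and> p < q" unfolding q_def by (rule LeastI_ex)
  moreover have "\<not> prime r" if "p < r" "r < q" for r
    using that not_less_Least unfolding q_def by blast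
  ultimately show thesis using assms that by (auto simp: consecutive_primes_def)
qed

lemma consecutive_primes_short_gap:
  assumes "consecutive_primes p q" "q \<le> p + 2"
  shows "p = 2 \<and> q = 3 \<or> q = p + 2"
proof -
  have "q = p + 1 \<or> q = p + 2" using assms by (auto simp: consecutive_primes_def)
  moreover have "p = 2" if "q = p + 1"
  proof (rule ccontr)
    assume "p \<noteq> 2"
    then have "odd p" "odd q" using assms that 
      by (auto simp: consecutive_primes_def) (metis primes_dvd_imp_eq two_is_prime_nat even_Suc prime_ge_2_nat not_less_eq_eq numeral_2_eq_2)+
    then show False using that by simp
  qed
  ultimately show ?thesis by auto
qed

text \<open>
  A prime \<open>p < x\<close> followed by a long gap has \<open>p + 1\<close> composite and at most \<open>x\<close>, so \<open>p + 1\<close> is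
  the first entry of its sequence even after the truncation and determines \<open>p\<close>.
\<close>
lemma card_S1: "card (S1 x) = card (long_gap_starts x)"
proof -
  define nxt where "nxt p = (THE q. consecutive_primes p q)" for p
  have nxt: "nxt p = q" if "consecutive_primes p q" for p q
    unfolding nxt_def using that consecutive_primes_unique by blast
  have "S1 x = (\<lambda>p. composite_seq x p (nxt p)) ` long_gap_starts x"
    unfolding S1_def long_gap_starts_def using nxt by blast
  moreover have hd: "hd (composite_seq x p (nxt p)) = Suc p" if p: "p \<in> long_gap_starts x" for p
  proof -
    obtain q where q: "consecutive_primes p q" "p + 2 < q" "p < x"
      using p unfolding long_gap_starts_def by blast
    then have "\<not> prime (Suc p)" "prime p" by (auto simp: consecutive_primes_def)
    then have "composite (Suc p)" using prime_gt_1_nat[of p] by (simp add: composite_def)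
    moreover have "[Suc p..<q] = Suc p # [Suc (Suc p)..<q]" using q by (simp add: upt_rec)
    ultimately show ?thesis using q by (simp add: composite_seq_def nxt[OF q(1)])
  qed
  then have "inj_on (\<lambda>p. composite_seq x p (nxt p)) (long_gap_starts x)"
    by (intro inj_onI) (metis Suc_inject)
  ultimately show ?thesis by (simp add: card_image)
qed

lemma finite_long_gap_starts [simp]: "finite (long_gap_starts x)"
  unfolding long_gap_starts_def by (rule finite_subset[of _ "{..<x}"]) auto

lemma card_long_gap_starts_le: "card (long_gap_starts x) \<le> prime_pi x"
  unfolding prime_pi_def
  by (intro card_mono) (auto simp: long_gap_starts_def consecutive_primes_def)

lemma prime_pi_le_card_long_gap_starts:
  assumes "\<not> prime x"
  shows "prime_pi x \<le> card (long_gap_starts x) + 1 + card (twin_primes_below x)"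
proof -
  have "{p. prime p \<and> p \<le> x} \<subseteq> long_gap_starts x \<union> {2} \<union> twin_primes_below x"
  proof
    fix p assume "p \<in> {p. prime p \<and> p \<le> x}"
    then have p: "prime p" "p < x" using assms by (auto simp: le_less)
    obtain q where q: "consecutive_primes p q" using p ex_consecutive_prime by blast
    then have "prime q" by (simp add: consecutive_primes_def)
    then show "p \<in> long_gap_starts x \<union> {2} \<union> twin_primes_below x"
      using consecutive_primes_short_gap[OF q] p q
      by (cases "q \<le> p + 2") (auto simp: long_gap_starts_def twin_primes_below_def)
  qed
  then have "prime_pi x \<le> card (long_gap_starts x \<union> {2} \<union> twin_primes_below x)"
    unfolding prime_pi_def by (intro card_mono) auto
  also have "\<dots> \<le> card (long_gap_starts x) + card {2::nat} + card (twin_primes_below x)"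
    by (meson add_le_mono1 card_Un_le order.trans)
  finally show ?thesis by simp
qed

lemma Union_S1_subset: "(\<Union>s\<in>S1 x. set s) \<subseteq> {1..x}"
  by (auto simp: S1_def composite_seq_def composite_def)

text \<open>
  A composite \<open>m \<le> x\<close> lies between the largest prime below it and the next one. If this gap
  is at most 2, then \<open>m\<close> is the middle of a pair of twin primes.
\<close>
lemma le_card_Union_S1:
  "x \<le> card (\<Union>s\<in>S1 x. set s) + 1 + prime_pi x + card (twin_primes_below x)"
proof -
  let ?U = "\<Union>s\<in>S1 x. set s"
  have finU: "finite ?U" using Union_S1_subset by (rule finite_subset) simp
  have "{1..x} \<subseteq> ?U \<union> {1} \<union> {p. prime p \<and> p \<le> x} \<union> Suc ` twin_primes_below x"
  proof
    fix m assume m: "m \<in> {1..x}"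
    show "m \<in> ?U \<union> {1} \<union> {p. prime p \<and> p \<le> x} \<union> Suc ` twin_primes_below x"
    proof (cases "m = 1 \<or> prime m")
      case True
      then show ?thesis using m by auto
    next
      case False
      then have comp: "composite m" using m by (auto simp: composite_def)
      then have "m > 2" using False by (auto simp: composite_def) (metis Suc_lessI numeral_2_eq_2 two_is_prime_nat)
      define A where "A = {p. prime p \<and> p < m}"
      define p where "p = Max A"
      have A: "finite A" "2 \<in> A" using \<open>m > 2\<close> by (auto simp: A_def)
      then have "p \<in> A" unfolding p_def by (intro Max_in) auto
      then have p: "prime p" "p < m" by (auto simp: A_def)
      have p_max: "r \<le> p" if "prime r" "r < m" for r
        unfolding p_def using A that by (intro Max_ge) (auto simp: A_def)
      obtain q where q: "consecutive_primes p q" using p ex_consecutive_prime by blast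
      then have q': "prime q" "p < q" by (auto simp: consecutive_primes_def)
      then have "q \<noteq> m" "\<not> q < m" using p_max[of q] False by auto
      then have "m < q" by simp
      show ?thesis
      proof (cases "p + 2 < q")
        case True
        moreover have "p < x" using p m by simp
        ultimately have "composite_seq x p q \<in> S1 x" using q unfolding S1_def by blast
        moreover have "m \<in> set (composite_seq x p q)"
          using comp m p \<open>m < q\<close> by (auto simp: composite_seq_def)
        ultimately show ?thesis by blast
      next
        case False
        then have "q = p + 2" using consecutive_primes_short_gap[OF q] p \<open>m < q\<close> by auto
        then have "p \<in> twin_primes_below x" "m = Suc p"
          using p q' \<open>m < q\<close> m by (auto simp: twin_primes_below_def)
        then show ?thesis by blast
      qed
    qed
  qed
  then have "card {1..x} \<le> card (?U \<union> {1} \<union> {p. prime p \<and> p \<le> x} \<union> Suc ` twin_primes_below x)"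
    using finU by (intro card_mono) auto
  also have "\<dots> \<le> card ?U + card {1::nat} + card {p. prime p \<and> p \<le> x} + card (Suc ` twin_primes_below x)"
    by (meson add_le_mono1 card_Un_le order.trans)
  finally show ?thesis by (simp add: card_image prime_pi_def)
qed

section \<open>The average length of the sequences\<close>

theorem theorem3p3:
  "((\<lambda>x::nat. real (prime_pi x) / (real x / avg_composites x)) \<longlongrightarrow> 1)
     (inf at_top (principal {x. odd x \<and> composite x}))"
proof -
  let ?F = "inf at_top (principal {x::nat. odd x \<and> composite x})"
  define T where "T x = real (card (twin_primes_below x))" for x
  define E where "E x = (1 + T x) * ln (real x) / ((real x - 1) * ln 2)" for x
  define e where "e x = 1 / real x + 8 / ln (real x) + T x / real x" for x
  have T0: "(\<lambda>x. T x * ln (real x) / real x) \<longlonglongrightarrow> 0"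
    unfolding T_def by (rule twin_primes_sparse)
  have "(\<lambda>x. T x * ln (real x) / real x * (1 / ln (real x))) \<longlonglongrightarrow> 0 * 0"
    by (intro tendsto_mult T0) real_asymp
  moreover have "\<forall>\<^sub>F x in sequentially. T x * ln (real x) / real x * (1 / ln (real x)) = T x / real x"
    using eventually_ge_at_top[of 2] by eventually_elim simp
  ultimately have "(\<lambda>x. T x / real x) \<longlonglongrightarrow> 0" using tendsto_cong by force
  moreover have "(\<lambda>x. 1 / real x + 8 / ln (real x)) \<longlonglongrightarrow> 0" by real_asymp
  ultimately have e: "e \<longlonglongrightarrow> 0" unfolding e_def using tendsto_add by fastforce
  have "(\<lambda>x. ln (real x) / ((real x - 1) * ln 2)
      + T x * ln (real x) / real x * (real x / ((real x - 1) * ln 2))) \<longlonglongrightarrow> 0 + 0 * inverse (ln 2)"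
    by (intro tendsto_add tendsto_mult T0) real_asymp+
  moreover have "\<forall>\<^sub>F x in sequentially. ln (real x) / ((real x - 1) * ln 2)
      + T x * ln (real x) / real x * (real x / ((real x - 1) * ln 2)) = E x"
    using eventually_ge_at_top[of 2] by eventually_elim (simp add: E_def add_divide_distrib distrib_right)
  ultimately have E: "E \<longlonglongrightarrow> 0" using tendsto_cong by force
  have le: "?F \<le> sequentially" by simp
  have ev: "\<forall>\<^sub>F x in ?F. odd x \<and> composite x \<and> x \<ge> 3 \<and> E x < 1"
    unfolding eventually_inf_principal
    using order_tendstoD(2)[OF E zero_less_one] eventually_ge_at_top[of 3] by eventually_elim simp
  have bounds: "1 - e x \<le> real (prime_pi x) / (real x / avg_composites x)
      \<and> real (prime_pi x) / (real x / avg_composites x) \<le> 1 / (1 - E x)"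
    if x: "odd x" "composite x" "x \<ge> 3" "E x < 1" for x
  proof -
    define U where "U = real (card (\<Union>s\<in>S1 x. set s))"
    define S where "S = real (card (S1 x))"
    define P where "P = real (prime_pi x)"
    have "card (\<Union>s\<in>S1 x. set s) \<le> card {1..x}" by (intro card_mono Union_S1_subset) auto
    then have U: "U \<le> real x" "real x \<le> U + 1 + P + T x"
      using le_card_Union_S1[of x] by (auto simp: U_def P_def T_def)
    have S: "S \<le> P" "P \<le> S + 1 + T x"
      using card_long_gap_starts_le[of x] prime_pi_le_card_long_gap_starts[of x] x
      by (auto simp: S_def P_def T_def card_S1 composite_def)
    have lnx: "ln (real x) > 0" using x by simp
    have Plow: "P \<ge> (real x - 1) * ln 2 / ln (real x)"
      unfolding P_def using x by (intro chebyshev_lower) auto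
    moreover have "(real x - 1) * ln 2 / ln (real x) > 0" using x lnx by simp
    ultimately have "P > 0" by linarith
    \<comment> \<open>By Chebyshev's lower bound, \<open>E x\<close> bounds the proportion of primes that start no sequence.\<close>
    have "1 + T x = E x * ((real x - 1) * ln 2 / ln (real x))"
      using x lnx by (simp add: E_def)
    also have "\<dots> \<le> E x * P"
      using Plow x lnx by (intro mult_left_mono) (auto simp: E_def T_def)
    finally have SP: "(1 - E x) * P \<le> S" using S by (simp add: algebra_simps)
    then have "S > 0" using \<open>P > 0\<close> x by (smt (verit) mult_pos_pos)
    have f: "real (prime_pi x) / (real x / avg_composites x) = U / real x * (P / S)"
      by (simp add: avg_composites_def U_def S_def P_def)
    have "P * ln (real x) \<le> 8 * real x" unfolding P_def using x by (intro chebyshev_upper) auto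
    then have "P / real x \<le> 8 / ln (real x)" using lnx x by (simp add: field_simps)
    then have "1 - e x \<le> 1 - 1 / real x - P / real x - T x / real x" by (simp add: e_def)
    also have "\<dots> = (real x - 1 - P - T x) / real x" using x by (simp add: diff_divide_distrib)
    also have "\<dots> \<le> U / real x * 1" using U x by (simp add: divide_right_mono)
    also have "\<dots> \<le> U / real x * (P / S)"
      using S \<open>S > 0\<close> by (intro mult_left_mono) (auto simp: U_def)
    finally have lo: "1 - e x \<le> U / real x * (P / S)" .
    have "U / real x * (P / S) \<le> 1 * (1 / (1 - E x))"
      using U x SP \<open>S > 0\<close> \<open>P > 0\<close> by (intro mult_mono) (auto simp: field_simps U_def)
    with lo show ?thesis unfolding f by simp
  qed
  show ?thesis
  proof (rule tendsto_sandwich)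
    show "\<forall>\<^sub>F x in ?F. 1 - e x \<le> real (prime_pi x) / (real x / avg_composites x)"
      "\<forall>\<^sub>F x in ?F. real (prime_pi x) / (real x / avg_composites x) \<le> 1 / (1 - E x)"
      using ev by (auto elim!: eventually_mono dest: bounds)
    have "((\<lambda>x. 1 - e x) \<longlongrightarrow> 1 - 0) sequentially" by (intro tendsto_intros e)
    then show "((\<lambda>x. 1 - e x) \<longlongrightarrow> 1) ?F" using tendsto_mono[OF le] by simp
    have "((\<lambda>x. 1 / (1 - E x)) \<longlongrightarrow> 1 / (1 - 0)) sequentially" by (intro tendsto_intros E) auto
    then show "((\<lambda>x. 1 / (1 - E x)) \<longlongrightarrow> 1) ?F" using tendsto_mono[OF le] by simp
  qed
qed
end
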